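(* Every hereditary small graph class admits an $O(\log^3 n)$-bit adjacency labeling scheme.
   Context: A class of graphs is a set of graphs closed under isomorphism; it is hereditary if closed under taking induced subgraphs. $\mathcal{X}_n$ denotes the set of graphs in $\mathcal{X}$ with vertex set $[n]$. A hereditary class $\mathcal{X}$ is small if there is a constant $c$ with $|\mathcal{X}_n|\le n!\cdot c^n$ for all $n$. For a function $b:\mathbb{N}\to\mathbb{N}$, a $b(n)$-bit adjacency labeling scheme for $\mathcal{X}$ is a pair (encoder, decoder) where for every $G\in\mathcal{X}_n$ the encoder assigns to each vertex a binary string of length $b(n)$ such that the decoder, which depends only on $\mathcal{X}$ and not on $G$, determines whether two vertices are adjacent from their two labels alone. *)

theory Defs
  imports
    Complex_Main
    "HOL-Library.Landau_Symbols"
    "Graph_Theory.Pair_Digraph"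
    "Graph_Theory.Digraph_Component"
    "Graph_Theory.Digraph_Isomorphism"
begin

text \<open>
  A finite simple graph is a \<open>pair_graph\<close>: a finite, loop-free, symmetric digraph without parallel
  arcs, an edge \<open>uv\<close> being represented by the two arcs \<open>(u,v)\<close> and \<open>(v,u)\<close>. The graph without
  vertices is allowed. Vertices are taken from \<^typ>\<open>nat\<close>, which contains an isomorphic copy of every
  finite graph. The library notions are those for general digraphs, reached through the
  coercion \<^const>\<open>with_proj\<close>.
\<close>

definition graph_class :: "nat pair_pre_digraph set \<Rightarrow> bool" where
  "graph_class X \<longleftrightarrow>
     (\<forall>G\<in>X. pair_graph G) \<and>
     (\<forall>G\<in>X. \<forall>H. pair_graph H \<and> digraph_iso (with_proj G) (with_proj H) \<longrightarrow> H \<in> X)"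

definition hereditary :: "nat pair_pre_digraph set \<Rightarrow> bool" where
  "hereditary X \<longleftrightarrow>
     graph_class X \<and>
     (\<forall>G\<in>X. \<forall>H. pair_graph H \<and> induced_subgraph (with_proj H) (with_proj G) \<longrightarrow> H \<in> X)"

definition labeled_graphs :: "nat pair_pre_digraph set \<Rightarrow> nat \<Rightarrow> nat pair_pre_digraph set" where
  "labeled_graphs X n = {G \<in> X. pverts G = {1..n}}"

definition small_class :: "nat pair_pre_digraph set \<Rightarrow> bool" where
  "small_class X \<longleftrightarrow> (\<exists>c::real. \<forall>n. real (card (labeled_graphs X n)) \<le> fact n * c ^ n)"

text \<open>
  Since \<^const>\<open>card\<close> is \<open>0\<close> on infinite sets, the definition of \<^const>\<open>small_class\<close> relies on
  the following fact.
\<close>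

lemma finite_labeled_graphs:
  assumes "graph_class X"
  shows "finite (labeled_graphs X n)"
proof (rule finite_subset)
  show "labeled_graphs X n \<subseteq>
      (\<lambda>E. \<lparr>pverts = {1..n}, parcs = E\<rparr>) ` Pow ({1..n} \<times> {1..n})"
  proof
    fix G assume G: "G \<in> labeled_graphs X n"
    then have "pair_graph G" and V: "pverts G = {1..n}"
      using assms by (auto simp: labeled_graphs_def graph_class_def)
    then interpret pair_graph G by simp
    have "parcs G \<subseteq> {1..n} \<times> {1..n}"
      using V by (auto dest: in_arcsD1 in_arcsD2)
    then show "G \<in> (\<lambda>E. \<lparr>pverts = {1..n}, parcs = E\<rparr>) ` Pow ({1..n} \<times> {1..n})"
      using V by (intro image_eqI[where x = "parcs G"]) auto
  qed
qed simp

text \<open>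
  On simple graphs, the library's digraph isomorphism (which also maps arcs) is the usual notion.
\<close>

lemma digraph_iso_pair_graph_iff:
  fixes G H :: "nat pair_pre_digraph"
  assumes "pair_graph G" "pair_graph H"
  shows "digraph_iso (with_proj G) (with_proj H) \<longleftrightarrow>
     (\<exists>f. bij_betw f (pverts G) (pverts H) \<and>
          (\<forall>u\<in>pverts G. \<forall>v\<in>pverts G. (f u, f v) \<in> parcs H \<longleftrightarrow> (u, v) \<in> parcs G))"
    (is "?L \<longleftrightarrow> ?R")
proof -
  interpret G: pair_graph G by fact
  interpret H: pair_graph H by fact
  show ?thesis
  proof
    assume ?L
    then obtain h where h: "pre_digraph.digraph_isomorphism (with_proj G) h"
      and H: "with_proj H = app_iso h (with_proj G)"
      by (auto simp: digraph_iso_def)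
    have V: "pverts H = iso_verts h ` pverts G" and A: "parcs H = iso_arcs h ` parcs G"
      and t: "iso_tail h = fst" and hd: "iso_head h = snd"
      using H by (auto simp: app_iso_def with_proj_def)
    have inj: "inj_on (iso_verts h) (pverts G)"
      and e: "\<And>a. a \<in> parcs G \<Longrightarrow> iso_arcs h a = (iso_verts h (fst a), iso_verts h (snd a))"
      using h t hd by (auto simp: pre_digraph.digraph_isomorphism_def prod_eq_iff)
    have "(iso_verts h u, iso_verts h v) \<in> parcs H \<longleftrightarrow> (u, v) \<in> parcs G"
      if "u \<in> pverts G" "v \<in> pverts G" for u v
    proof
      assume "(iso_verts h u, iso_verts h v) \<in> parcs H"
      then obtain a b where ab: "(a, b) \<in> parcs G"
        "iso_verts h u = iso_verts h a" "iso_verts h v = iso_verts h b"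
        using A e by auto
      moreover have "a \<in> pverts G" "b \<in> pverts G"
        using ab(1) by (auto dest: G.in_arcsD1 G.in_arcsD2)
      ultimately have "u = a" "v = b"
        using that inj by (auto dest: inj_onD)
      with ab show "(u, v) \<in> parcs G" by simp
    next
      assume "(u, v) \<in> parcs G"
      then show "(iso_verts h u, iso_verts h v) \<in> parcs H"
        using A e by force
    qed
    then show ?R using V inj by (auto simp: bij_betw_def)
  next
    assume ?R
    then obtain f where bij: "bij_betw f (pverts G) (pverts H)"
      and ad: "\<And>u v. u \<in> pverts G \<Longrightarrow> v \<in> pverts G \<Longrightarrow>
        (f u, f v) \<in> parcs H \<longleftrightarrow> (u, v) \<in> parcs G"
      by auto
    define h where "h = \<lparr>iso_verts = f, iso_arcs = map_prod f f,
      iso_head = (snd :: nat \<times> nat \<Rightarrow> nat), iso_tail = (fst :: nat \<times> nat \<Rightarrow> nat)\<rparr>"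
    have inj: "inj_on f (pverts G)" using bij by (simp add: bij_betw_def)
    have "inj_on (map_prod f f) (parcs G)"
      by (rule inj_on_subset[OF map_prod_inj_on[OF inj inj]])
        (auto dest: G.in_arcsD1 G.in_arcsD2)
    then have "pre_digraph.digraph_isomorphism (with_proj G) h"
      using inj G.wf_digraph_axioms by (simp add: pre_digraph.digraph_isomorphism_def h_def)
    moreover have "parcs H = map_prod f f ` parcs G"
    proof (intro set_eqI iffI)
      fix p assume p: "p \<in> parcs H"
      then have "fst p \<in> f ` pverts G" "snd p \<in> f ` pverts G"
        using bij by (auto simp: bij_betw_def H.arc_fst_in_verts H.arc_snd_in_verts)
      then obtain u v where "u \<in> pverts G" "v \<in> pverts G" "p = (f u, f v)"
        by (metis imageE prod.collapse)
      then show "p \<in> map_prod f f ` parcs G" using p ad by force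
    next
      fix p assume "p \<in> map_prod f f ` parcs G"
      then obtain u v where "(u, v) \<in> parcs G" "p = (f u, f v)" by auto
      then show "p \<in> parcs H" using ad by (auto dest: G.in_arcsD1 G.in_arcsD2)
    qed
    then have "with_proj H = app_iso h (with_proj G)"
      using bij by (simp add: app_iso_def with_proj_def h_def bij_betw_def)
    ultimately show ?L by (auto simp: digraph_iso_def)
  qed
qed

type_synonym encoder = "nat pair_pre_digraph \<Rightarrow> nat \<Rightarrow> bool list"
type_synonym decoder = "bool list \<Rightarrow> bool list \<Rightarrow> bool"

text \<open>
  The two vertices presented to the decoder may coincide; a vertex is not adjacent to itself.
\<close>

definition adjacency_labeling_scheme ::
    "(nat \<Rightarrow> nat) \<Rightarrow> nat pair_pre_digraph set \<Rightarrow> encoder \<Rightarrow> decoder \<Rightarrow> bool" where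
  "adjacency_labeling_scheme b X enc dec \<longleftrightarrow>
     (\<forall>n. \<forall>G\<in>labeled_graphs X n.
        (\<forall>v\<in>pverts G. length (enc G v) = b n) \<and>
        (\<forall>u\<in>pverts G. \<forall>v\<in>pverts G. dec (enc G u) (enc G v) \<longleftrightarrow> (u, v) \<in> parcs G))"

end

theory Submission
  imports Defs
begin

text \<open>
  Fix a set \<open>A\<close> of \<open>n\<close> vertices of a graph in the class. Adding \<open>n log n\<close> vertices with distinct
  neighbourhoods on \<open>A\<close> in all possible orders produces pairwise different labelled graphs, so
  smallness bounds the number of traces of neighbourhoods on \<open>A\<close> by \<open>O(n log n)\<close>. In particular the
  VC dimension is bounded, and Haussler's packing argument shows that among any \<open>r\<close> vertices of an
  \<open>n\<close>-vertex graph, two have neighbourhoods differing in only \<open>O(n log n / r)\<close> vertices. Removing one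
  vertex of such a pair, ordering the others recursively and reinserting the vertex next to its partner
  gives an ordering along which an average neighbourhood changes membership \<open>O(log\<^sup>2 n)\<close> times. At
  least half of the vertices stay below twice the average and store the list of changes. The other
  vertices store just their position and recurse among themselves. A label thus consists of
  \<open>O(log n)\<close> positions and \<open>O(log\<^sup>2 n)\<close> changes, at \<open>O(log n)\<close> bits each.
\<close>

section \<open>The Haussler packing argument\<close>

text \<open>
  A weighted form of Haussler's bound on the edges of the unit distance graph of a set family of
  VC dimension below \<open>d\<close>. When an element \<open>x\<close> is removed, each pair \<open>P\<close>, \<open>insert x P\<close> is replaced
  by its maximum \<open>hi\<close> and its minimum \<open>lo\<close>; the latter has smaller dimension.
\<close>

lemma cube_edge_weight_le:
  fixes w :: "'a set \<Rightarrow> nat"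
  assumes "finite A"
    and "\<And>S. S \<subseteq> A \<Longrightarrow> card S = d \<Longrightarrow> \<exists>Q\<subseteq>S. \<forall>P\<subseteq>A. P \<inter> S = Q \<longrightarrow> w P = 0"
  shows "(\<Sum>a\<in>A. \<Sum>P\<in>Pow (A - {a}). min (w P) (w (insert a P))) \<le> d * (\<Sum>P\<in>Pow A. w P)"
  using assms
proof (induction A arbitrary: w d rule: finite_induct)
  case empty
  then show ?case by simp
next
  case (insert x A)
  note ns = insert.prems
  define hi where "hi P = max (w P) (w (insert x P))" for P
  define lo where "lo P = min (w P) (w (insert x P))" for P
  let ?e = "\<lambda>f. \<Sum>a\<in>A. \<Sum>P\<in>Pow (A - {a}). min (f P) (f (insert a P)) :: nat"
  have split: "(\<Sum>P\<in>Pow (insert x B). f P) = (\<Sum>P\<in>Pow B. f P + f (insert x P))"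
    if "finite B" "x \<notin> B" for B and f :: "'a set \<Rightarrow> nat"
  proof -
    have "inj_on (insert x) (Pow B)"
      using that(2) by (auto simp: inj_on_def)
    moreover have "Pow B \<inter> insert x ` Pow B = {}"
      using that(2) by auto
    ultimately show ?thesis
      using that(1) by (simp add: Pow_insert sum.union_disjoint sum.reindex sum.distrib)
  qed
  have total: "(\<Sum>P\<in>Pow (insert x A). w P) = (\<Sum>P\<in>Pow A. hi P) + (\<Sum>P\<in>Pow A. lo P)"
    unfolding split[OF insert.hyps(1,2)] sum.distrib[symmetric] hi_def lo_def
    by (intro sum.cong) auto
  \<comment> \<open>Two parallel edges in direction \<open>a\<close>, one with and one without
    \<open>x\<close>, span a square. Sorting its values into maxima and minima does not decrease the
    total edge weight.\<close>
  have "(\<Sum>P\<in>Pow (insert x A - {a}). min (w P) (w (insert a P)))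
      \<le> (\<Sum>P\<in>Pow (A - {a}). min (hi P) (hi (insert a P)) + min (lo P) (lo (insert a P)))"
    if "a \<in> A" for a
  proof -
    have "insert x A - {a} = insert x (A - {a})" using that insert.hyps by auto
    then show ?thesis
      using insert.hyps
      by (simp add: split) (intro sum_mono, auto simp: hi_def lo_def insert_commute[of a x])
  qed
  then have "(\<Sum>a\<in>A. \<Sum>P\<in>Pow (insert x A - {a}). min (w P) (w (insert a P))) \<le> ?e hi + ?e lo"
    unfolding sum.distrib[symmetric] by (intro sum_mono) auto
  then have edges: "(\<Sum>a\<in>insert x A. \<Sum>P\<in>Pow (insert x A - {a}). min (w P) (w (insert a P)))
      \<le> ?e hi + ?e lo + (\<Sum>P\<in>Pow A. lo P)"
    using insert.hyps by (simp add: lo_def)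
  have hi: "?e hi \<le> d * (\<Sum>P\<in>Pow A. hi P)"
  proof (rule insert.IH)
    fix S assume S: "S \<subseteq> A" "card S = d"
    then obtain Q where Q: "Q \<subseteq> S" "\<And>P. P \<subseteq> insert x A \<Longrightarrow> P \<inter> S = Q \<Longrightarrow> w P = 0"
      using ns[of S] by blast
    have "hi P = 0" if "P \<subseteq> A" "P \<inter> S = Q" for P
    proof -
      have "insert x P \<inter> S = Q" using that S insert.hyps by auto
      then show ?thesis using Q(2)[of P] Q(2)[of "insert x P"] that by (auto simp: hi_def subset_insertI2)
    qed
    then show "\<exists>Q\<subseteq>S. \<forall>P\<subseteq>A. P \<inter> S = Q \<longrightarrow> hi P = 0" using Q(1) by blast
  qed
  \<comment> \<open>The minima miss a trace already on sets of \<open>d - 1\<close> elements. The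
    copy of the \<open>lo\<close> sum saved by this pays for the edges in direction
    \<open>x\<close>, whose weight is \<open>lo P\<close>.\<close>
  have lo: "?e lo + (\<Sum>P\<in>Pow A. lo P) \<le> d * (\<Sum>P\<in>Pow A. lo P)"
  proof (cases d)
    case 0
    then have "w P = 0" if "P \<subseteq> insert x A" for P
      using ns[of "{}"] that by auto
    then have "lo P = 0" if "P \<subseteq> A" for P using that by (simp add: lo_def subset_insertI2)
    moreover from this have "lo P = 0" if "P \<in> Pow (A - {a})" for P a
      using that by blast
    then have "?e lo = 0" by (intro sum.neutral ballI) simp
    ultimately show ?thesis by simp
  next
    case (Suc m)
    have "?e lo \<le> m * (\<Sum>P\<in>Pow A. lo P)"
    proof (rule insert.IH)
      fix S assume S: "S \<subseteq> A" "card S = m"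
      then have "card (insert x S) = d"
        using insert.hyps Suc by (metis card_insert_disjoint finite_subset subsetD)
      moreover have "insert x S \<subseteq> insert x A" using S by auto
      ultimately obtain Q where Q: "Q \<subseteq> insert x S"
        "\<And>P. P \<subseteq> insert x A \<Longrightarrow> P \<inter> insert x S = Q \<Longrightarrow> w P = 0"
        using ns[of "insert x S"] by blast
      \<comment> \<open>Whichever of \<open>P\<close> and \<open>insert x P\<close> has trace
        \<open>Q\<close> on \<open>insert x S\<close> has weight 0, hence so has the
        minimum.\<close>
      have "lo P = 0" if P: "P \<subseteq> A" "P \<inter> S = Q - {x}" for P
      proof (cases "x \<in> Q")
        case True
        then have "insert x P \<inter> insert x S = Q" using P by auto
        then show ?thesis using Q(2)[of "insert x P"] P by (auto simp: lo_def subset_insertI2)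
      next
        case False
        moreover have "x \<notin> P" using P(1) insert.hyps by auto
        ultimately have "P \<inter> insert x S = Q" using P by auto
        then show ?thesis using Q(2)[of P] P by (auto simp: lo_def subset_insertI2)
      qed
      then show "\<exists>Q\<subseteq>S. \<forall>P\<subseteq>A. P \<inter> S = Q \<longrightarrow> lo P = 0"
        using Q(1) by (intro exI[of _ "Q - {x}"]) auto
    qed
    then show ?thesis using Suc by simp
  qed
  show ?case
    using edges hi lo unfolding total by (simp add: distrib_left)
qed

text \<open>Count triples of \<open>u\<close>, \<open>v\<close> and \<open>a\<close> with
  \<open>a\<close> in \<open>N u\<close> but not in \<open>N v\<close>. A distinct pair gives at
  least \<delta> of them in its two orders together. An \<open>a\<close> in \<open>Y\<close> gives a
  product of two numbers with sum \<open>card C\<close>, hence at most \<open>card C\<close> times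
  the smaller one.\<close>

lemma separated_split:
  fixes N :: "'b \<Rightarrow> 'a set"
  assumes fin: "finite C" "finite Y"
    and sep: "\<And>u v. u \<in> C \<Longrightarrow> v \<in> C \<Longrightarrow> u \<noteq> v \<Longrightarrow>
      \<delta> \<le> card ((N u - N v \<union> (N v - N u)) \<inter> Y)"
  shows "(card C - 1) * \<delta>
    \<le> 2 * (\<Sum>a\<in>Y. min (card {u\<in>C. a \<notin> N u}) (card {u\<in>C. a \<in> N u}))"
proof (cases "C = {}")
  case False
  let ?D = "\<lambda>u v. card ((N u - N v) \<inter> Y)"
  let ?m = "\<lambda>a. min (card {u\<in>C. a \<notin> N u}) (card {u\<in>C. a \<in> N u})"
  have prod: "card {u\<in>C. a \<in> N u} * card {u\<in>C. a \<notin> N u} \<le> card C * ?m a" for a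
  proof -
    have "card {u\<in>C. a \<in> N u} \<le> card C" "card {u\<in>C. a \<notin> N u} \<le> card C"
      using fin by (auto intro: card_mono)
    then show ?thesis by (auto simp: min_def intro: mult_le_mono)
  qed
  have "(\<Sum>u\<in>C. \<Sum>v\<in>C. ?D u v) = (\<Sum>u\<in>C. \<Sum>v\<in>C. \<Sum>a\<in>Y. of_bool (a \<in> N u) * of_bool (a \<notin> N v))"
    using fin by (intro sum.cong refl) (simp add: of_bool_conj[symmetric] Int_def conj_commute)
  also have "\<dots> = (\<Sum>a\<in>Y. \<Sum>u\<in>C. \<Sum>v\<in>C. of_bool (a \<in> N u) * of_bool (a \<notin> N v))"
    by (simp add: sum.swap[of _ Y])
  also have "\<dots> = (\<Sum>a\<in>Y. card {u\<in>C. a \<in> N u} * card {u\<in>C. a \<notin> N u})"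
  proof -
    have "card {u\<in>C. P u} = (\<Sum>u\<in>C. of_bool (P u))" for P
      using fin(1) by (simp add: Int_def)
    then show ?thesis by (simp only: sum_product)
  qed
  also have "\<dots> \<le> card C * (\<Sum>a\<in>Y. ?m a)"
    unfolding sum_distrib_left by (intro sum_mono prod)
  finally have up: "(\<Sum>u\<in>C. \<Sum>v\<in>C. ?D u v) \<le> card C * (\<Sum>a\<in>Y. ?m a)" .
  have "card C * ((card C - 1) * \<delta>) = (\<Sum>u\<in>C. \<Sum>v\<in>C - {u}. \<delta>)"
    using fin by simp
  also have "\<dots> \<le> (\<Sum>u\<in>C. \<Sum>v\<in>C - {u}. ?D u v + ?D v u)"
  proof (intro sum_mono)
    fix u v assume uv: "u \<in> C" "v \<in> C - {u}"
    from uv have "u \<noteq> v" by auto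
    with uv have "\<delta> \<le> card ((N u - N v) \<inter> Y \<union> (N v - N u) \<inter> Y)"
      using sep[of u v] by (simp add: Int_Un_distrib2)
    also have "\<dots> \<le> ?D u v + ?D v u" by (rule card_Un_le)
    finally show "\<delta> \<le> ?D u v + ?D v u" .
  qed
  also have "\<dots> \<le> (\<Sum>u\<in>C. \<Sum>v\<in>C. ?D u v + ?D v u)"
    using fin by (intro sum_mono sum_mono2) auto
  also have "\<dots> = 2 * (\<Sum>u\<in>C. \<Sum>v\<in>C. ?D u v)"
    using sum.swap[of "\<lambda>u v. ?D v u" C C] by (simp add: sum.distrib)
  also have "\<dots> \<le> card C * (2 * (\<Sum>a\<in>Y. ?m a))" using up by simp
  finally show ?thesis using False fin by (simp add: card_gt_0_iff)
qed simp

lemma sum_card_fibres: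
  assumes "finite U" "finite T" "g ` U \<subseteq> T"
  shows "(\<Sum>y\<in>T. card {u\<in>U. g u = y}) = card U"
  using sum.group[OF assms, of "\<lambda>_. 1 :: nat"] by simp

text \<open>
  Double counting, over all \<open>A \<subseteq> W\<close> with \<open>t + 1\<close> elements, of the total unit distance edge weight \<open>f\<close>
  of the traces on \<open>A\<close>.
\<close>

lemma haussler_packing:
  fixes N :: "'b \<Rightarrow> 'a set"
  assumes fin: "finite U" "finite W" and t: "t < card W"
    and sep: "\<And>u v. u \<in> U \<Longrightarrow> v \<in> U \<Longrightarrow> u \<noteq> v \<Longrightarrow>
      \<delta> \<le> card ((N u - N v \<union> (N v - N u)) \<inter> W)"
    and vc: "\<And>S. S \<subseteq> W \<Longrightarrow> card S = d \<Longrightarrow> \<exists>Q\<subseteq>S. \<forall>u\<in>U. N u \<inter> S \<noteq> Q"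
    and traces: "\<And>B. B \<subseteq> W \<Longrightarrow> card B = t \<Longrightarrow> card ((\<lambda>u. N u \<inter> B) ` U) \<le> g"
  shows "Suc t * ((card U - g) * \<delta>) \<le> 2 * card W * d * card U"
proof -
  define w where "w A Q = card {u\<in>U. N u \<inter> A = Q}" for A Q
  define f where "f B a = (\<Sum>P\<in>Pow B. min (w (insert a B) P) (w (insert a B) (insert a P)))" for B a
  let ?SA = "{A. A \<subseteq> W \<and> card A = Suc t}" and ?SB = "{B. B \<subseteq> W \<and> card B = t}"
  have fin': "finite A" if "A \<subseteq> W" for A using that fin finite_subset by blast
  have upper: "(\<Sum>a\<in>A. f (A - {a}) a) \<le> d * card U" if A: "A \<subseteq> W" for A
  proof -
    have "(\<Sum>a\<in>A. f (A - {a}) a)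
        = (\<Sum>a\<in>A. \<Sum>P\<in>Pow (A - {a}). min (w A P) (w A (insert a P)))"
      by (intro sum.cong refl) (auto simp: f_def insert_absorb)
    also have "\<dots> \<le> d * (\<Sum>P\<in>Pow A. w A P)"
    proof (rule cube_edge_weight_le[OF fin'[OF A]])
      fix S assume S: "S \<subseteq> A" "card S = d"
      then obtain Q where "Q \<subseteq> S" "\<forall>u\<in>U. N u \<inter> S \<noteq> Q" using vc A by blast
      moreover have "w A P = 0" if "P \<inter> S = Q" for P
      proof -
        have "{u\<in>U. N u \<inter> A = P} = {}" using that S(1) \<open>\<forall>u\<in>U. N u \<inter> S \<noteq> Q\<close> by auto
        then show ?thesis by (simp only: w_def card.empty)
      qed
      ultimately show "\<exists>Q\<subseteq>S. \<forall>P\<subseteq>A. P \<inter> S = Q \<longrightarrow> w A P = 0" by blast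
    qed
    also have "(\<Sum>P\<in>Pow A. w A P) = card U"
      unfolding w_def using fin(1) fin'[OF A] by (intro sum_card_fibres) auto
    finally show ?thesis .
  qed
  \<comment> \<open>Members of one class \<open>C P\<close> agree on \<open>B\<close>, so they stay
    \<delta>-separated on \<open>W - B\<close>. Each of the at most \<open>g\<close> classes loses
    one member in \<open>separated_split\<close>, whence \<open>card U - g\<close>.\<close>
  have lower: "(card U - g) * \<delta> \<le> 2 * (\<Sum>a\<in>W - B. f B a)" if B: "B \<subseteq> W" "card B = t" for B
  proof -
    define T where "T = (\<lambda>u. N u \<inter> B) ` U"
    define C where "C P = {u\<in>U. N u \<inter> B = P}" for P
    have T: "finite T" "T \<subseteq> Pow B" "card T \<le> g"
      using fin traces[OF B] by (auto simp: T_def)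
    have "(\<Sum>P\<in>T. card (C P)) = card U"
      unfolding C_def using fin(1) T(1) by (intro sum_card_fibres) (auto simp: T_def)
    moreover have "(\<Sum>P\<in>T. card (C P)) \<le> (\<Sum>P\<in>T. (card (C P) - 1) + 1)" 
      by (intro sum_mono) auto
    then have "(\<Sum>P\<in>T. card (C P)) \<le> (\<Sum>P\<in>T. card (C P) - 1) + card T"
      by (simp only: sum.distrib) simp
    ultimately have "card U - g \<le> (\<Sum>P\<in>T. card (C P) - 1)" using T(3) by simp
    then have "(card U - g) * \<delta> \<le> (\<Sum>P\<in>T. (card (C P) - 1) * \<delta>)"
      by (simp add: sum_distrib_right[symmetric])
    also have "\<dots> \<le> (\<Sum>P\<in>T. 2 * (\<Sum>a\<in>W - B. min (card {u\<in>C P. a \<notin> N u}) (card {u\<in>C P. a \<in> N u})))"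
    proof (intro sum_mono separated_split)
      fix P u v assume uv: "u \<in> C P" "v \<in> C P" "u \<noteq> v"
      then have "(N u - N v \<union> (N v - N u)) \<inter> (W - B) = (N u - N v \<union> (N v - N u)) \<inter> W"
        by (auto simp: C_def)
      then show "\<delta> \<le> card ((N u - N v \<union> (N v - N u)) \<inter> (W - B))"
        using uv sep by (simp add: C_def)
    qed (use fin in \<open>auto simp: C_def\<close>)
    also have "\<dots> \<le> (\<Sum>P\<in>Pow B. 2 * (\<Sum>a\<in>W - B. min (card {u\<in>C P. a \<notin> N u}) (card {u\<in>C P. a \<in> N u})))"
      using T fin'[OF B(1)] by (intro sum_mono2) auto
    also have "\<dots> = (\<Sum>P\<in>Pow B. 2 * (\<Sum>a\<in>W - B. min (w (insert a B) P) (w (insert a B) (insert a P))))"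
    proof (intro sum.cong refl arg_cong[where f = "(*) 2"])
      fix P a assume "P \<in> Pow B" "a \<in> W - B"
      then have "{u\<in>C P. a \<notin> N u} = {u\<in>U. N u \<inter> insert a B = P}"
        "{u\<in>C P. a \<in> N u} = {u\<in>U. N u \<inter> insert a B = insert a P}"
        by (auto simp: C_def)
      then show "min (card {u\<in>C P. a \<notin> N u}) (card {u\<in>C P. a \<in> N u})
        = min (w (insert a B) P) (w (insert a B) (insert a P))" by (simp add: w_def)
    qed
    also have "\<dots> = 2 * (\<Sum>a\<in>W - B. f B a)"
      unfolding f_def by (simp add: sum_distrib_left[symmetric] sum.swap[of _ "Pow B"])
    finally show ?thesis .
  qed
  have finS: "finite ?SA" "finite ?SB" using fin by auto
  have cS: "card ?SA = card W choose Suc t" "card ?SB = card W choose t"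
    using fin n_subsets by auto
  have "card ?SB * ((card U - g) * \<delta>) \<le> (\<Sum>B\<in>?SB. 2 * (\<Sum>a\<in>W - B. f B a))"
    using sum_bounded_below[of ?SB "(card U - g) * \<delta>" "\<lambda>B. 2 * (\<Sum>a\<in>W - B. f B a)"] lower by simp
  also have "\<dots> = 2 * (\<Sum>(B, a)\<in>(SIGMA B:?SB. W - B). f B a)"
    using fin finS by (simp add: sum.Sigma sum_distrib_left[symmetric])
  also have "(\<Sum>(B, a)\<in>(SIGMA B:?SB. W - B). f B a) = (\<Sum>(A, a)\<in>(SIGMA A:?SA. A). f (A - {a}) a)"
    by (rule sum.reindex_bij_witness[of _ "\<lambda>(A, a). (A - {a}, a)" "\<lambda>(B, a). (insert a B, a)"])
      (auto simp: insert_absorb fin' dest: fin')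
  also have "\<dots> = (\<Sum>A\<in>?SA. \<Sum>a\<in>A. f (A - {a}) a)"
    using finS fin' by (simp add: sum.Sigma)
  also have "\<dots> \<le> card ?SA * (d * card U)"
    using sum_bounded_above[of ?SA "\<lambda>A. \<Sum>a\<in>A. f (A - {a}) a" "d * card U"] upper by simp
  finally have main: "card ?SB * ((card U - g) * \<delta>) \<le> 2 * (card ?SA * (d * card U))" by simp
  have "Suc t * card ?SA \<le> card W * card ?SB"
  proof -
    have "Suc t * card ?SA = (card W - t) * card ?SB"
      unfolding cS by (simp only: binomial_absorb_comp binomial_absorption)
    then show ?thesis by simp
  qed
  from mult_le_mono1[OF this, of "2 * (d * card U)"] mult_le_mono2[OF main, of "Suc t"]
  have "card ?SB * (Suc t * ((card U - g) * \<delta>)) \<le> card ?SB * (2 * card W * d * card U)"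
    by (simp only: mult_ac)
  moreover have "card ?SB > 0" using t by (simp add: cS)
  ultimately show ?thesis by simp
qed

section \<open>Consequences of few traces: no large shattered sets, close pairs\<close>

text \<open>Here \<open>L\<close> is any upper bound on the binary logarithm of
  \<open>card A\<close>; the added ones cover empty \<open>A\<close> and
  \<open>L = 0\<close>.\<close>

definition near_linear_traces :: "('a \<Rightarrow> 'a set) \<Rightarrow> 'a set \<Rightarrow> nat \<Rightarrow> bool" where
  "near_linear_traces N V D \<longleftrightarrow>
     (\<forall>A L. A \<subseteq> V \<longrightarrow> card A \<le> 2 ^ L \<longrightarrow>
        card ((\<lambda>u. N u \<inter> A) ` V) \<le> D * (card A + 1) * (L + 1))"

lemma near_linear_tracesD:
  assumes "near_linear_traces N V D" "finite V" "U \<subseteq> V" "A \<subseteq> V" "card A \<le> 2 ^ L"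
  shows "card ((\<lambda>u. N u \<inter> A) ` U) \<le> D * (card A + 1) * (L + 1)"
proof -
  have "card ((\<lambda>u. N u \<inter> A) ` U) \<le> card ((\<lambda>u. N u \<inter> A) ` V)"
    using assms by (intro card_mono image_mono) auto
  also have "\<dots> \<le> D * (card A + 1) * (L + 1)"
    using assms by (simp add: near_linear_traces_def)
  finally show ?thesis .
qed

lemma near_linear_traces_subset:
  assumes "near_linear_traces N V D" "finite V" "W \<subseteq> V"
  shows "near_linear_traces N W D"
  using near_linear_tracesD[OF assms(1,2,3)] assms(3)
  unfolding near_linear_traces_def by (meson subset_trans)

text \<open>A shattered \<open>S\<close> has \<open>2 ^ card S\<close> traces, too many for a
  near-linear bound once \<open>card S\<close> is this large compared with \<open>D\<close>.\<close>

lemma near_linear_traces_not_shattered: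
  assumes N: "near_linear_traces N V D" and V: "finite V" "U \<subseteq> V"
    and S: "S \<subseteq> V" "card S = 2 ^ (D + 3)"
  shows "\<exists>Q\<subseteq>S. \<forall>u\<in>U. N u \<inter> S \<noteq> Q"
proof (rule ccontr)
  assume "\<not> ?thesis"
  then have sub: "Pow S \<subseteq> (\<lambda>u. N u \<inter> S) ` U" by auto
  have "(2::nat) ^ 2 ^ (D + 3) = card (Pow S)"
    using S V card_Pow finite_subset by metis
  also have "\<dots> \<le> card ((\<lambda>u. N u \<inter> S) ` U)"
    using sub finite_subset[OF V(2,1)] by (intro card_mono finite_imageI)
  also have "\<dots> \<le> D * (2 ^ (D + 3) + 1) * (D + 3 + 1)"
    using near_linear_tracesD[OF N V S(1), of "D + 3"] S(2) by simp
  also have "\<dots> \<le> D * (2 ^ (D + 3) * 2) * 2 ^ (D + 3)"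
  proof (intro mult_le_mono le_refl)
    show "(2::nat) ^ (D + 3) + 1 \<le> 2 ^ (D + 3) * 2" by simp
    show "D + 3 + 1 \<le> 2 ^ (D + 3)" by (metis Suc_eq_plus1 Suc_leI less_exp)
  qed
  also have "\<dots> < 2 ^ D * (2 ^ (D + 3) * 2) * 2 ^ (D + 3)"
    by (simp add: less_exp)
  also have "\<dots> = (2::nat) ^ (D + (D + 3) + 1 + (D + 3))"
    by (simp only: power_add power_one_right mult_ac)
  also have "\<dots> \<le> 2 ^ 2 ^ (D + 3)"
  proof (rule power_increasing)
    have "D + 1 \<le> 2 ^ D" by (simp add: Suc_le_eq)
    moreover have "(2::nat) ^ (D + 3) = 8 * 2 ^ D" by (simp add: power_add)
    ultimately show "D + (D + 3) + 1 + (D + 3) \<le> 2 ^ (D + 3)" by linarith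
  qed simp
  finally show False by simp
qed

text \<open>The power \<open>2 ^ (D + 3)\<close> is the size at which sets are no longer shattered;
  the other factors come from bounding \<open>2 * g * \<delta>\<close> in
  \<open>close_pair\<close>.\<close>

definition packing_const :: "nat \<Rightarrow> nat" where
  "packing_const D = 2 * D * (4 * 2 ^ (D + 3) + 1)"

text \<open>Otherwise \<open>U\<close> is \<delta>-separated with \<delta> just above the claimed
  bound divided by \<open>card U\<close>, and this contradicts the packing bound for a suitable
  \<open>t\<close>.\<close>

lemma close_pair:
  assumes N: "near_linear_traces N W D" and W: "finite W" "card W \<le> 2 ^ L"
    and U: "U \<subseteq> W" "2 \<le> card U"
  shows "\<exists>u\<in>U. \<exists>v\<in>U. u \<noteq> v \<and>
    card U * card ((N u - N v \<union> (N v - N u)) \<inter> W) \<le> packing_const D * card W * (L + 1)"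
proof (rule ccontr)
  let ?\<Delta> = "\<lambda>u v. card ((N u - N v \<union> (N v - N u)) \<inter> W)"
  let ?n = "card W" and ?r = "card U"
  define M where "M = packing_const D * ?n * (L + 1)"
  define d :: nat where "d = 2 ^ (D + 3)"
  define \<delta> where "\<delta> = M div ?r + 1"
  \<comment> \<open>With \<open>4 * ?n * d < Suc t * \<delta>\<close>, the packing bound makes
    \<open>?r - g\<close> at most half of \<open>?r\<close>.\<close>
  define t where "t = 4 * ?n * d div \<delta>"
  assume "\<not> ?thesis"
  then have far: "M < ?r * ?\<Delta> u v" if "u \<in> U" "v \<in> U" "u \<noteq> v" for u v
    using that by (auto simp: M_def not_le)
  have sep: "\<delta> \<le> ?\<Delta> u v" if "u \<in> U" "v \<in> U" "u \<noteq> v" for u v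
  proof -
    have "M div ?r < ?\<Delta> u v"
      using far[OF that] U(2) by (simp add: less_mult_imp_div_less mult.commute)
    then show ?thesis by (simp add: \<delta>_def)
  qed
  have M: "M < ?r * \<delta>"
    using U(2) dividend_less_times_div[of ?r M] by (simp add: \<delta>_def)
  have finU: "finite U" using U W finite_subset by blast
  obtain u v where uv: "u \<in> U" "v \<in> U" "u \<noteq> v"
    using U(2) card_le_Suc0_iff_eq[OF finU] by fastforce
  have "\<delta> \<le> ?n"
    using sep[OF uv] card_mono[OF W(1), of "(N u - N v \<union> (N v - N u)) \<inter> W"] by simp
  have "\<delta> > 0" by (simp add: \<delta>_def)
  have "?n > 0" using uv U(1) W(1) by (auto simp: card_gt_0_iff)
  have t\<delta>: "t * \<delta> \<le> 4 * ?n * d" by (simp add: t_def)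
  have t\<delta>': "4 * ?n * d < Suc t * \<delta>"
    using dividend_less_times_div[of \<delta> "4 * ?n * d"] \<open>\<delta> > 0\<close> by (simp add: t_def mult.commute)
  have "?r * \<delta> \<le> M"
  proof (cases "t < ?n")
    case True
    define g where "g = D * Suc t * (L + 1)"
    have "Suc t * ((?r - g) * \<delta>) \<le> 2 * ?n * d * ?r"
    proof (rule haussler_packing[OF finU W(1) True])
      show "\<exists>Q\<subseteq>S. \<forall>u\<in>U. N u \<inter> S \<noteq> Q" if "S \<subseteq> W" "card S = d" for S
        using near_linear_traces_not_shattered[OF N W(1) U(1)] that by (simp add: d_def)
      show "card ((\<lambda>u. N u \<inter> B) ` U) \<le> g" if "B \<subseteq> W" "card B = t" for B
        using near_linear_tracesD[OF N W(1) U(1) that(1), of L] that True W(2)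
        by (simp add: g_def)
    qed (use sep in auto)
    then have "(?r - g) * (4 * ?n * d) \<le> (2 * ?n * d) * ?r"
      using mult_le_mono2[OF less_imp_le[OF t\<delta>'], of "?r - g"] by (simp only: mult_ac)
    then have "2 * ?n * d * (2 * (?r - g)) \<le> 2 * ?n * d * ?r" by (simp add: mult_ac)
    then have "2 * (?r - g) \<le> ?r" using \<open>?n > 0\<close> by (simp add: d_def)
    then have "?r \<le> 2 * g" by linarith
    then have "?r * \<delta> \<le> 2 * g * \<delta>" by simp
    also have "\<dots> = 2 * D * (L + 1) * (t * \<delta> + \<delta>)" by (simp add: g_def algebra_simps)
    also have "\<dots> \<le> 2 * D * (L + 1) * (4 * ?n * d + ?n)"
      using t\<delta> \<open>\<delta> \<le> ?n\<close> by (intro mult_le_mono2 add_mono)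
    also have "\<dots> = M" by (simp add: M_def packing_const_def d_def algebra_simps)
    finally show ?thesis .
  next
    \<comment> \<open>The packing bound needs \<open>t < ?n\<close>. Otherwise \<delta> is at most
      \<open>4 * d\<close>, and it suffices to count the traces on all of \<open>W\<close>, which
      are distinct by separation.\<close>
    case False
    have "inj_on (\<lambda>u. N u \<inter> W) U"
    proof (rule inj_onI, rule ccontr)
      fix u v assume "u \<in> U" "v \<in> U" "N u \<inter> W = N v \<inter> W" "u \<noteq> v"
      moreover from this have "(N u - N v \<union> (N v - N u)) \<inter> W = {}" by auto
      ultimately have "\<delta> \<le> 0" using sep[of u v] by (metis card.empty)
      then show False by (simp add: \<delta>_def)
    qed
    then have "?r \<le> D * (?n + 1) * (L + 1)"
      using near_linear_tracesD[OF N W(1) U(1), of W L] W(2) by (simp add: card_image)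
    then have "?r * \<delta> \<le> D * (?n + 1) * (L + 1) * \<delta>" by simp
    also have "\<dots> = D * (L + 1) * (?n * \<delta> + \<delta>)" by (simp add: algebra_simps)
    also have "\<dots> \<le> D * (L + 1) * (4 * ?n * d + ?n)"
    proof (intro mult_le_mono2 add_mono)
      have "?n * \<delta> \<le> t * \<delta>" using False by simp
      then show "?n * \<delta> \<le> 4 * ?n * d" using t\<delta> by linarith
    qed fact
    also have "\<dots> \<le> M" by (simp add: M_def packing_const_def d_def algebra_simps)
    finally show ?thesis .
  qed
  with M show False by simp
qed

section \<open>Orderings with few membership changes\<close>

fun path_length :: "('a \<Rightarrow> 'a \<Rightarrow> nat) \<Rightarrow> 'a list \<Rightarrow> nat" where
  "path_length d (x # y # zs) = d x y + path_length d (y # zs)"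
| "path_length d _ = 0"

lemma path_length_append:
  "path_length d (xs @ y # ys) = path_length d (xs @ [y]) + path_length d (y # ys)"
  by (induction xs rule: induct_list012) (auto split: list.splits simp: neq_Nil_conv)

lemma path_length_snoc:
  "xs \<noteq> [] \<Longrightarrow> path_length d (xs @ [y]) = path_length d xs + d (last xs) y"
  by (induction d xs rule: path_length.induct) auto

lemma path_length_sum:
  "path_length (\<lambda>u v. \<Sum>w\<in>W. d w u v) xs = (\<Sum>w\<in>W. path_length (d w) xs)"
  by (induction xs rule: induct_list012) (auto simp: sum.distrib)

text \<open>With \<open>u\<close> placed right after \<open>v\<close>, the detour costs at most
  \<open>2 * d u v\<close> by the triangle inequality.\<close>

lemma path_insert:
  assumes tri: "\<And>x y z. d x z \<le> d x y + d y z" and sym: "\<And>x y. d x y = d y x"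
    and l: "distinct l" "v \<in> set l" "u \<notin> set l"
  shows "\<exists>l'. distinct l' \<and> set l' = insert u (set l) \<and> path_length d l' \<le> path_length d l + 2 * d u v"
proof -
  obtain xs ys where l': "l = xs @ v # ys" using l(2) by (meson split_list)
  have "path_length d (v # u # ys) \<le> path_length d (v # ys) + 2 * d u v"
    using tri[of u "hd ys" v] sym[of u v] by (cases ys) auto
  then have "path_length d (xs @ v # u # ys) \<le> path_length d l + 2 * d u v"
    using path_length_append[of d xs v ys] path_length_append[of d xs v "u # ys"] by (simp add: l')
  then show ?thesis using l unfolding l' by (intro exI[of _ "xs @ v # u # ys"]) auto
qed

text \<open>Taking one member of a close pair out of a set of \<open>i\<close> elements and
  reinserting it later costs at most \<open>2 * M / i\<close>; these costs add up to the harmonic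
  sum.\<close>

lemma short_path:
  assumes tri: "\<And>x y z. d x z \<le> d x y + d y z" and sym: "\<And>x y. d x y = d y x"
    and W: "finite W"
    and close: "\<And>U. U \<subseteq> W \<Longrightarrow> 2 \<le> card U \<Longrightarrow> \<exists>u\<in>U. \<exists>v\<in>U. u \<noteq> v \<and> card U * d u v \<le> M"
  shows "\<exists>l. distinct l \<and> set l = W \<and> real (path_length d l) \<le> 2 * real M * (\<Sum>i=1..card W. 1 / real i)"
proof -
  have "\<exists>l. distinct l \<and> set l = U \<and> real (path_length d l) \<le> 2 * real M * (\<Sum>i=1..k. 1 / real i)"
    if "U \<subseteq> W" "card U = k" for U k
    using that
  proof (induction k arbitrary: U)
    case 0
    then have "U = {}" using W finite_subset by (metis card_0_eq)
    then show ?case by simp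
  next
    case (Suc k)
    have fin: "finite U" using Suc W finite_subset by blast
    show ?case
    proof (cases "k = 0")
      case True
      then obtain x where "U = {x}" using Suc.prems by (auto simp: card_1_singleton_iff)
      then show ?thesis by (intro exI[of _ "[x]"]) (auto intro!: mult_nonneg_nonneg add_nonneg_nonneg sum_nonneg)
    next
      case False
      then obtain u v where uv: "u \<in> U" "v \<in> U" "u \<noteq> v" "Suc k * d u v \<le> M"
        using close[of U] Suc.prems by auto
      have "card (U - {u}) = k" "U - {u} \<subseteq> W" using uv Suc.prems fin by auto
      then obtain l where l: "distinct l" "set l = U - {u}"
        "real (path_length d l) \<le> 2 * real M * (\<Sum>i=1..k. 1 / real i)"
        using Suc.IH by blast
      obtain l' where l': "distinct l'" "set l' = insert u (set l)"
        "path_length d l' \<le> path_length d l + 2 * d u v"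
        using path_insert[of d, OF tri sym, of l v u] l uv by auto
      have "real (Suc k * d u v) \<le> real M" using uv(4) by (simp only: of_nat_le_iff)
      then have "real (d u v) \<le> M * (1 / real (Suc k))" by (simp add: field_simps)
      then have "real (path_length d l') \<le> 2 * real M * (\<Sum>i=1..k. 1 / real i) + 2 * (M * (1 / real (Suc k)))"
        using l(3) l'(3) by linarith
      also have "\<dots> = 2 * real M * (\<Sum>i=1..Suc k. 1 / real i)" by (simp add: algebra_simps)
      finally show ?thesis using l' l(2) uv by (intro exI[of _ l']) auto
    qed
  qed
  then show ?thesis by blast
qed

text \<open>Each doubling of the range adds \<open>2 ^ L\<close> terms of size at most
  \<open>1 / 2 ^ L\<close>.\<close>

lemma harmonic_sum_le:
  assumes "n \<le> 2 ^ L"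
  shows "(\<Sum>i=1..n. 1 / real i) \<le> real L + 1"
proof -
  have "(\<Sum>i=1..2 ^ L. 1 / real i) \<le> real L + 1"
  proof (induction L)
    case (Suc L)
    have "(\<Sum>i=1..2 ^ Suc L. 1 / real i)
        = (\<Sum>i=1..2 ^ L. 1 / real i) + (\<Sum>i=2 ^ L + 1..2 ^ L + 2 ^ L. 1 / real i)"
      using sum.ub_add_nat[of 1 "2 ^ L" "\<lambda>i. 1 / real i" "2 ^ L"] by (simp add: mult_2)
    moreover have "(\<Sum>i=2 ^ L + 1..2 ^ L + 2 ^ L. 1 / real i) \<le> (\<Sum>i=2 ^ L + 1..2 ^ L + (2::nat) ^ L. 1 / 2 ^ L)"
    proof (intro sum_mono divide_left_mono)
      fix i assume "i \<in> {2 ^ L + 1..2 ^ L + (2::nat) ^ L}"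
      then have "(2::nat) ^ L \<le> i" by simp
      then have "real (2 ^ L) \<le> real i" by (simp only: of_nat_le_iff)
      then show "2 ^ L \<le> real i" by simp
      then show "0 < real i * 2 ^ L" by (metis less_le_trans mult_pos_pos zero_less_numeral zero_less_power)
    qed simp
    ultimately show ?case using Suc by simp
  qed simp
  moreover have "(\<Sum>i=1..n. 1 / real i) \<le> (\<Sum>i=1..2 ^ L. 1 / real i)"
    using assms by (intro sum_mono2) auto
  ultimately show ?thesis by linarith
qed

text \<open>
  A subset of an initial segment of the naturals is stored as the list \<open>c\<close> of positions where
  membership changes.
\<close>

definition mem_switches :: "nat list \<Rightarrow> nat \<Rightarrow> bool" where
  "mem_switches c q \<longleftrightarrow> odd (length (filter (\<lambda>p. p \<le> q) c))"

text \<open>A position is recorded only where membership differs from that of the predecessor. The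
  extra 1 is for a first element that is a member.\<close>

lemma ex_switches:
  "\<exists>c. length c \<le> 1 + path_length (\<lambda>u v. of_bool (\<chi> u \<noteq> \<chi> v)) l \<and> set c \<subseteq> {..<length l} \<and>
    (\<forall>i<length l. mem_switches c i \<longleftrightarrow> \<chi> (l ! i))"
proof (induction l rule: rev_induct)
  case Nil
  then show ?case by (intro exI[of _ "[]"]) simp
next
  case (snoc x l)
  then obtain c where c: "length c \<le> 1 + path_length (\<lambda>u v. of_bool (\<chi> u \<noteq> \<chi> v)) l"
    "set c \<subseteq> {..<length l}" "\<And>i. i < length l \<Longrightarrow> mem_switches c i \<longleftrightarrow> \<chi> (l ! i)" by blast
  have all: "filter (\<lambda>p. p \<le> i) c = c" if "length l \<le> Suc i" for i
    using c(2) that by (intro filter_True) auto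
  show ?case
  proof (cases "l = []")
    case True
    then show ?thesis
      by (intro exI[of _ "if \<chi> x then [0] else []"]) (auto simp: mem_switches_def)
  next
    case False
    \<comment> \<open>All recorded positions precede \<open>length l\<close>, so the parity of
      \<open>length c\<close> is the membership of the last element.\<close>
    have last: "odd (length c) \<longleftrightarrow> \<chi> (last l)"
      using c(3)[of "length l - 1"] all[of "length l - 1"] False
      by (simp add: mem_switches_def last_conv_nth)
    show ?thesis
      using False c last all[of "length l"]
      by (intro exI[of _ "if \<chi> x = \<chi> (last l) then c else c @ [length l]"])
        (auto simp: path_length_snoc nth_append mem_switches_def less_Suc_eq all)
  qed
qed

text \<open>Twice the bound \<open>K\<close> on the average number of changes in
  \<open>low_switch_half\<close>, plus the 1 from \<open>ex_switches\<close>.\<close>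

definition level_const :: "nat \<Rightarrow> nat \<Rightarrow> nat" where
  "level_const D L = 4 * packing_const D * (L + 1) * (L + 1) + 1"

text \<open>Path length for the symmetric difference metric is the total number of membership
  changes over all neighbourhoods. So a short path makes the average small, and Markov's inequality
  gives \<open>Z\<close>.\<close>

lemma low_switch_half:
  fixes N :: "'a \<Rightarrow> 'a set"
  assumes N: "near_linear_traces N W D" and W: "finite W" "card W \<le> 2 ^ L"
    and sym: "\<forall>u\<in>W. \<forall>v\<in>W. u \<in> N v \<longleftrightarrow> v \<in> N u"
  shows "\<exists>pos Z. Z \<subseteq> W \<and> 2 * card (W - Z) \<le> card W \<and> pos ` W \<subseteq> {..<card W} \<and>
    (\<forall>w\<in>Z. \<exists>c. length c \<le> level_const D L \<and> set c \<subseteq> {..<card W} \<and>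
      (\<forall>v\<in>W. mem_switches c (pos v) \<longleftrightarrow> v \<in> N w))"
proof -
  define \<Delta> where "\<Delta> u v = card ((N u - N v \<union> (N v - N u)) \<inter> W)" for u v
  define M where "M = packing_const D * card W * (L + 1)"
  define K where "K = 2 * packing_const D * (L + 1) * (L + 1)"
  have "\<exists>l. distinct l \<and> set l = W \<and> real (path_length \<Delta> l) \<le> 2 * real M * (\<Sum>i=1..card W. 1 / real i)"
  proof (rule short_path[OF _ _ W(1)])
    fix x y z
    have "\<Delta> x z \<le> card ((N x - N y \<union> (N y - N x)) \<inter> W \<union> (N y - N z \<union> (N z - N y)) \<inter> W)"
      unfolding \<Delta>_def using W(1) by (intro card_mono) auto
    also have "\<dots> \<le> \<Delta> x y + \<Delta> y z"
      unfolding \<Delta>_def by (rule card_Un_le)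
    finally show "\<Delta> x z \<le> \<Delta> x y + \<Delta> y z" .
    show "\<Delta> x y = \<Delta> y x" by (simp add: \<Delta>_def Un_commute)
  next
    fix U assume "U \<subseteq> W" "2 \<le> card U"
    then show "\<exists>u\<in>U. \<exists>v\<in>U. u \<noteq> v \<and> card U * \<Delta> u v \<le> M"
      unfolding \<Delta>_def M_def by (rule close_pair[OF N W])
  qed
  then obtain l where l: "distinct l" "set l = W"
    "real (path_length \<Delta> l) \<le> 2 * real M * (\<Sum>i=1..card W. 1 / real i)" by blast
  define cr where "cr w = path_length (\<lambda>u v. of_bool ((u \<in> N w) \<noteq> (v \<in> N w))) l" for w
  \<comment> \<open>The path length counts changes of \<open>w \<in> N u\<close> along the path,
    whereas a label stores changes of \<open>u \<in> N w\<close>. Symmetry identifies the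
    two.\<close>
  define cr' where "cr' w = path_length (\<lambda>u v. of_bool ((w \<in> N u) \<noteq> (w \<in> N v))) l" for w
  have cr: "cr w = cr' w" if "w \<in> W" for w
  proof -
    have "path_length (\<lambda>u v. of_bool ((u \<in> N w) \<noteq> (v \<in> N w))) xs
        = path_length (\<lambda>u v. of_bool ((w \<in> N u) \<noteq> (w \<in> N v))) xs" if "set xs \<subseteq> W" for xs
      using that by (induction xs rule: induct_list012) (auto simp: sym \<open>w \<in> W\<close>)
    then show ?thesis using l(2) by (simp add: cr_def cr'_def)
  qed
  have "\<Delta> = (\<lambda>u v. \<Sum>w\<in>W. of_bool ((w \<in> N u) \<noteq> (w \<in> N v)))"
  proof (intro ext)
    fix u v
    have "(N u - N v \<union> (N v - N u)) \<inter> W = W \<inter> {w. (w \<in> N u) \<noteq> (w \<in> N v)}" by auto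
    then show "\<Delta> u v = (\<Sum>w\<in>W. of_bool ((w \<in> N u) \<noteq> (w \<in> N v)))"
      using W(1) by (simp add: \<Delta>_def)
  qed
  then have sum_cr: "path_length \<Delta> l = (\<Sum>w\<in>W. cr w)"
    by (simp add: path_length_sum cr cr'_def cong: sum.cong)
  have "real (path_length \<Delta> l) \<le> 2 * real M * (real L + 1)"
    using l(3) mult_left_mono[OF harmonic_sum_le[OF W(2)], of "2 * real M"] by simp
  also have "\<dots> = real (card W * K)"
    by (simp add: M_def K_def algebra_simps)
  finally have total: "(\<Sum>w\<in>W. cr w) \<le> card W * K" unfolding sum_cr of_nat_le_iff .
  define Z where "Z = {w\<in>W. cr w \<le> 2 * K}"
  have "2 * card (W - Z) \<le> card W"
  \<comment> \<open>Markov's inequality divides by \<open>K\<close>; for \<open>K = 0\<close> there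
    are no changes at all.\<close>
  proof (cases "K = 0")
    case True
    then have "Z = W" using total W(1) by (auto simp: Z_def)
    then show ?thesis by simp
  next
    case False
    have "2 * K \<le> cr w" if "w \<in> W - Z" for w using that by (auto simp: Z_def)
    from sum_bounded_below[of "W - Z" "2 * K" cr, OF this]
    have "card (W - Z) * (2 * K) \<le> (\<Sum>w\<in>W - Z. cr w)" by simp
    also have "\<dots> \<le> (\<Sum>w\<in>W. cr w)" using W(1) by (intro sum_mono2) auto
    finally have "(2 * card (W - Z)) * K \<le> card W * K"
      using total by (simp only: mult_ac)
    then show ?thesis using False by (simp only: mult_le_cancel2)
  qed
  moreover
  have "\<exists>i<length l. l ! i = v" if "v \<in> W" for v
    using that l(2) by (simp add: in_set_conv_nth[symmetric])
  then obtain pos where pos: "\<And>v. v \<in> W \<Longrightarrow> pos v < length l \<and> l ! pos v = v" by metis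
  have len: "length l = card W" using l distinct_card by fastforce
  have "\<exists>c. length c \<le> level_const D L \<and> set c \<subseteq> {..<card W} \<and>
      (\<forall>v\<in>W. mem_switches c (pos v) \<longleftrightarrow> v \<in> N w)" if "w \<in> Z" for w
  proof -
    obtain c where "length c \<le> 1 + cr w" "set c \<subseteq> {..<length l}"
      "\<forall>i<length l. mem_switches c i \<longleftrightarrow> l ! i \<in> N w"
      using ex_switches[of "\<lambda>v. v \<in> N w" l] unfolding cr_def by blast
    moreover have "1 + cr w \<le> level_const D L"
      using that by (simp add: Z_def K_def level_const_def algebra_simps)
    ultimately show ?thesis using pos len by (intro exI[of _ c]) auto
  qed
  ultimately show ?thesis
    using pos len by (intro exI[of _ pos] exI[of _ Z]) (auto simp: Z_def)
qed

section \<open>Labels\<close>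

text \<open>
  The first component lists the positions of a vertex in the successive orderings, up to the one in
  which it has few changes; the second component lists these changes. Of two vertices, the one that
  drops out first decides about adjacency.
\<close>

fun dec_label :: "nat list \<times> nat list \<Rightarrow> nat list \<times> nat list \<Rightarrow> bool" where
  "dec_label (p # ps, c) (q # qs, d) =
     (if ps = [] then mem_switches c q
      else if qs = [] then mem_switches d p
      else dec_label (ps, c) (qs, d))"
| "dec_label _ _ = False"

text \<open>At least half of the vertices drop out at each level, so \<open>k\<close> levels
  suffice. Position lists are claimed nonempty because the decoder recognises a vertex that drops
  out by its list ending there.\<close>

lemma ex_labels:
  fixes N :: "'a \<Rightarrow> 'a set"
  assumes "near_linear_traces N W D" "finite W" "card W \<le> 2 ^ L"
    and "\<forall>u\<in>W. \<forall>v\<in>W. u \<in> N v \<longleftrightarrow> v \<in> N u"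
    and "card W < 2 ^ k"
  shows "\<exists>lab. (\<forall>v\<in>W. fst (lab v) \<noteq> [] \<and> length (fst (lab v)) \<le> k \<and>
        length (snd (lab v)) \<le> level_const D L \<and>
        set (fst (lab v)) \<union> set (snd (lab v)) \<subseteq> {..<card W}) \<and>
      (\<forall>u\<in>W. \<forall>v\<in>W. dec_label (lab u) (lab v) \<longleftrightarrow> v \<in> N u)"
  using assms
proof (induction k arbitrary: W)
  case 0
  then have "W = {}" by simp
  then show ?case by simp
next
  case (Suc k)
  note W = Suc.prems
  from low_switch_half[OF W(1-4)] obtain pos Z
    where Z: "Z \<subseteq> W" "2 * card (W - Z) \<le> card W" and pos: "pos ` W \<subseteq> {..<card W}"
      and "\<forall>w\<in>Z. \<exists>c. length c \<le> level_const D L \<and> set c \<subseteq> {..<card W} \<and>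
        (\<forall>v\<in>W. mem_switches c (pos v) \<longleftrightarrow> v \<in> N w)"
    by (elim exE conjE) (rule that)
  from bchoice[OF this(4)] obtain c
    where c: "\<forall>w\<in>Z. length (c w) \<le> level_const D L \<and> set (c w) \<subseteq> {..<card W} \<and>
      (\<forall>v\<in>W. mem_switches (c w) (pos v) \<longleftrightarrow> v \<in> N w)"
    by (elim exE) (rule that)
  have le: "card (W - Z) \<le> card W" using W(2) by (simp add: card_mono)
  have sub: "near_linear_traces N (W - Z) D" "finite (W - Z)" "card (W - Z) \<le> 2 ^ L" "card (W - Z) < 2 ^ k"
    using near_linear_traces_subset[OF W(1,2)] W(2,3,5) Z(2) le by auto
  have "\<forall>u\<in>W - Z. \<forall>v\<in>W - Z. u \<in> N v \<longleftrightarrow> v \<in> N u" using W(4) by blast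
  from Suc.IH[OF sub(1-3) this sub(4)] obtain lab where
    lab: "\<And>v. v \<in> W - Z \<Longrightarrow> fst (lab v) \<noteq> [] \<and> length (fst (lab v)) \<le> k \<and>
        length (snd (lab v)) \<le> level_const D L \<and>
        set (fst (lab v)) \<union> set (snd (lab v)) \<subseteq> {..<card (W - Z)}"
      "\<And>u v. u \<in> W - Z \<Longrightarrow> v \<in> W - Z \<Longrightarrow> dec_label (lab u) (lab v) \<longleftrightarrow> v \<in> N u"
    by blast
  define lab' where "lab' v = (if v \<in> Z then ([pos v], c v) else (pos v # fst (lab v), snd (lab v)))" for v
  have bounds: "fst (lab' v) \<noteq> [] \<and> length (fst (lab' v)) \<le> Suc k \<and>
        length (snd (lab' v)) \<le> level_const D L \<and>
        set (fst (lab' v)) \<union> set (snd (lab' v)) \<subseteq> {..<card W}" if "v \<in> W" for v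
  proof (cases "v \<in> Z")
    case True
    then show ?thesis using bspec[OF c, of v] pos that by (auto simp: lab'_def)
  next
    case False
    moreover have "{..<card (W - Z)} \<subseteq> {..<card W}" using le by auto
    ultimately show ?thesis using lab(1)[of v] pos that by (auto simp: lab'_def)
  qed
  have "dec_label (lab' u) (lab' v) \<longleftrightarrow> v \<in> N u" if uv: "u \<in> W" "v \<in> W" for u v
  proof (cases "u \<in> Z \<or> v \<in> Z")
    \<comment> \<open>If only \<open>v\<close> lies in \<open>Z\<close>, the decoder reads the
      changes of \<open>v\<close> and answers \<open>u \<in> N v\<close>; symmetry gives
      \<open>v \<in> N u\<close>.\<close>
    case True
    then show ?thesis
      using bspec[OF c, of u] bspec[OF c, of v] bspec[OF bspec[OF W(4) uv(1)] uv(2)] uv lab(1)[of u] lab(1)[of v]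
      by (auto simp: lab'_def)
  next
    case False
    then have "fst (lab u) \<noteq> []" "fst (lab v) \<noteq> []" using lab(1) uv by auto
    then show ?thesis using False lab(2)[of u v] uv by (simp add: lab'_def)
  qed
  with bounds show ?case by (intro exI[of _ lab']) simp
qed

section \<open>Bit strings: self-delimiting codes and padding\<close>

text \<open>\<open>True\<close> announces a further binary digit and \<open>False\<close> ends the
  number, so codes can be concatenated without separators.\<close>

fun nat_code :: "nat \<Rightarrow> bool list" where
  "nat_code n = (if n = 0 then [False] else True # odd n # nat_code (n div 2))"

declare nat_code.simps [simp del]

lemma nat_code_prefix_free:
  "nat_code m @ xs = nat_code n @ ys \<Longrightarrow> m = n \<and> xs = ys"
proof (induction m arbitrary: n rule: nat_code.induct)
  case (1 m)
  show ?case
  proof (cases "m = 0 \<or> n = 0")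
    case True
    then show ?thesis using "1.prems" by (auto simp: nat_code.simps[of m] nat_code.simps[of n] split: if_splits)
  next
    case False
    then have "odd m = odd n" "nat_code (m div 2) @ xs = nat_code (n div 2) @ ys"
      using "1.prems" by (auto simp: nat_code.simps[of m] nat_code.simps[of n])
    with "1.IH"[of "n div 2"] False have "m div 2 = n div 2" "m mod 2 = n mod 2" "xs = ys"
      by (auto simp: odd_iff_mod_2_eq_one even_iff_mod_2_eq_zero)
    then show ?thesis by (metis div_mult_mod_eq)
  qed
qed

lemma length_nat_code: "n < 2 ^ k \<Longrightarrow> length (nat_code n) \<le> 2 * k + 1"
proof (induction k arbitrary: n)
  case (Suc k)
  then have "length (nat_code (n div 2)) \<le> 2 * k + 1" by (intro Suc.IH) auto
  then show ?case by (simp add: nat_code.simps[of n])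
qed (simp add: nat_code.simps)

lemma nat_code_neq_Nil: "nat_code n \<noteq> []"
  by (simp add: nat_code.simps)

text \<open>Prefix-freeness peels off one codeword at a time; nonempty codewords settle lists of
  different lengths.\<close>

lemma inj_list_code: "inj (\<lambda>xs. concat (map nat_code xs))"
proof (rule injI)
  fix xs ys assume "concat (map nat_code xs) = concat (map nat_code ys)"
  then show "xs = ys"
  proof (induction xs arbitrary: ys)
    case Nil
    then show ?case by (cases ys) (auto simp: nat_code_neq_Nil)
  next
    case (Cons x xs)
    then obtain y ys' where "ys = y # ys'" by (cases ys) (auto simp: nat_code_neq_Nil)
    with Cons show ?case by (auto dest!: nat_code_prefix_free)
  qed
qed

text \<open>The marker \<open>True\<close> lets the decoder remove the padding without knowing
  \<open>m\<close>.\<close>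

definition pad :: "nat \<Rightarrow> bool list \<Rightarrow> bool list" where
  "pad m xs = xs @ True # replicate (m - length xs) False"

definition unpad :: "bool list \<Rightarrow> bool list" where
  "unpad ys = rev (tl (dropWhile Not (rev ys)))"

lemma unpad_pad: "unpad (pad m xs) = xs"
  by (simp add: pad_def unpad_def dropWhile_append3 dropWhile_append2)

lemma length_pad: "length xs \<le> m \<Longrightarrow> length (pad m xs) = Suc m"
  by (simp add: pad_def)

text \<open>The leading \<open>length ps\<close> tells where \<open>ps\<close> ends and
  \<open>c\<close> begins.\<close>

definition encode_label :: "nat list \<times> nat list \<Rightarrow> bool list" where
  "encode_label t = (case t of (ps, c) \<Rightarrow> concat (map nat_code (length ps # ps @ c)))"

lemma inj_encode_label: "inj encode_label"
proof (rule injI)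
  fix s t assume eq: "encode_label s = encode_label t"
  obtain ps c qs d where st: "s = (ps, c)" "t = (qs, d)" by (metis surj_pair)
  have "length ps # ps @ c = length qs # qs @ d"
    using injD[OF inj_list_code] eq unfolding st encode_label_def prod.case by blast
  then have "length ps = length qs" "ps @ c = qs @ d" by simp_all
  then show "s = t" by (simp add: st)
qed

lemma length_concat_le:
  "(\<And>x. x \<in> set xs \<Longrightarrow> length (f x) \<le> m) \<Longrightarrow> length (concat (map f xs)) \<le> length xs * m"
  by (induction xs) (auto intro: add_mono)

lemma length_encode_label:
  assumes "length ps < 2 ^ k" "set ps \<union> set c \<subseteq> {..<2 ^ k}"
  shows "length (encode_label (ps, c)) \<le> (1 + length ps + length c) * (2 * k + 1)"
proof -
  have "length (concat (map nat_code (length ps # ps @ c))) \<le> length (length ps # ps @ c) * (2 * k + 1)"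
    using assms by (intro length_concat_le length_nat_code) auto
  then show ?thesis by (simp add: encode_label_def)
qed

section \<open>Trace counts in small hereditary classes\<close>

abbreviation nbhd :: "'a pair_pre_digraph \<Rightarrow> 'a \<Rightarrow> 'a set" where
  "nbhd G u \<equiv> {v. (u, v) \<in> parcs G}"

lemma pair_graph_iff:
  "pair_graph G \<longleftrightarrow> finite (pverts G) \<and> parcs G \<subseteq> pverts G \<times> pverts G \<and> sym (parcs G) \<and> irrefl (parcs G)"
proof
  assume "pair_graph G"
  then interpret pair_graph G .
  show "finite (pverts G) \<and> parcs G \<subseteq> pverts G \<times> pverts G \<and> sym (parcs G) \<and> irrefl (parcs G)"
    using pair_finite_verts pair_sym_arcs
    by (auto simp: symmetric_def irrefl_def dest: in_arcsD1 in_arcsD2 pair_no_loops)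
next
  assume *: "finite (pverts G) \<and> parcs G \<subseteq> pverts G \<times> pverts G \<and> sym (parcs G) \<and> irrefl (parcs G)"
  then have "finite (parcs G)" by (meson finite_SigmaI finite_subset)
  interpret pair_wf_digraph G
    using * by unfold_locales auto
  show "pair_graph G"
    using * \<open>finite (parcs G)\<close> by unfold_locales (auto simp: symmetric_def irrefl_def)
qed

lemma hereditary_pair_graph:
  assumes "hereditary X" "G \<in> X"
  shows "finite (pverts G)" "parcs G \<subseteq> pverts G \<times> pverts G" "sym (parcs G)" "irrefl (parcs G)"
proof -
  have "pair_graph G" using assms unfolding hereditary_def graph_class_def by blast
  then show "finite (pverts G)" "parcs G \<subseteq> pverts G \<times> pverts G" "sym (parcs G)" "irrefl (parcs G)"
    by (simp_all add: pair_graph_iff)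
qed

text \<open>The induced subgraph on the image of \<phi> lies in the class; it is then renamed along
  the inverse of \<phi>.\<close>

lemma hereditary_pullback:
  assumes X: "hereditary X" "G \<in> X"
    and \<phi>: "inj_on \<phi> I" "finite I" "\<phi> ` I \<subseteq> pverts G"
  shows "\<lparr>pverts = I, parcs = {(i, j). i \<in> I \<and> j \<in> I \<and> (\<phi> i, \<phi> j) \<in> parcs G}\<rparr> \<in> X"
    (is "?H \<in> X")
proof -
  define G' where "G' = \<lparr>pverts = \<phi> ` I, parcs = parcs G \<inter> \<phi> ` I \<times> \<phi> ` I\<rparr>"
  have G: "pair_graph G" using hereditary_pair_graph[OF X] by (simp add: pair_graph_iff)
  have G': "pair_graph G'" and H: "pair_graph ?H"
    using G \<phi>(2) by (auto simp: pair_graph_iff G'_def sym_def irrefl_def)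
  interpret G: pair_graph G by (rule G)
  interpret G': pair_graph G' by (rule G')
  have "induced_subgraph (with_proj G') (with_proj G)"
    using \<phi>(3) G.wf_digraph_axioms G'.wf_digraph_axioms
    by (auto simp: induced_subgraph_def subgraph_def compatible_def G'_def with_proj_def)
  then have "G' \<in> X" using X G' unfolding hereditary_def by blast
  moreover have "digraph_iso (with_proj G') (with_proj ?H)"
  proof -
    have "the_inv_into I \<phi> (\<phi> i) = i" if "i \<in> I" for i
      using the_inv_into_f_f[OF \<phi>(1) that] .
    then have "\<exists>f. bij_betw f (pverts G') (pverts ?H) \<and>
      (\<forall>u\<in>pverts G'. \<forall>v\<in>pverts G'. (f u, f v) \<in> parcs ?H \<longleftrightarrow> (u, v) \<in> parcs G')"
      using inj_on_imp_bij_betw[OF \<phi>(1)]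
      by (intro exI[of _ "the_inv_into I \<phi>"]) (auto simp: G'_def bij_betw_the_inv_into)
    then show ?thesis by (simp only: digraph_iso_pair_graph_iff[OF G' H])
  qed
  ultimately show ?thesis using X H unfolding hereditary_def graph_class_def by blast
qed

text \<open>The vertices in \<open>B\<close> are told apart by their traces on \<open>A\<close>. So once \<open>A\<close> carries a fixed
  labelling, each sequence of \<open>k\<close> distinct elements of \<open>B\<close> yields another labelled graph.\<close>

lemma labeled_graphs_ge:
  assumes X: "hereditary X" "G \<in> X"
    and A: "A \<subseteq> pverts G" and B: "B \<subseteq> pverts G - A" "k \<le> card B"
    and inj: "inj_on (\<lambda>u. nbhd G u \<inter> A) B"
  shows "(card B - k) ^ k \<le> card (labeled_graphs X (card A + k))"
proof -
  define n where "n = card A"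
  have fin: "finite A" "finite B"
    using hereditary_pair_graph(1)[OF X] A B(1) by (auto intro: finite_subset)
  obtain \<alpha> where \<alpha>: "bij_betw \<alpha> {1..n} A"
    using ex_bij_betw_nat_finite_1[OF fin(1)] n_def by blast
  \<comment> \<open>Labels up to \<open>n\<close> name the vertices of \<open>A\<close> and later
    ones the entries of \<open>xs\<close>, hence the index shift.\<close>
  define \<phi> where "\<phi> xs i = (if i \<le> n then \<alpha> i else xs ! (i - n - 1))" for xs i
  define H where "H xs = \<lparr>pverts = {1..n + k},
    parcs = {(i, j). i \<in> {1..n + k} \<and> j \<in> {1..n + k} \<and> (\<phi> xs i, \<phi> xs j) \<in> parcs G}\<rparr>" for xs
  let ?S = "{xs. length xs = k \<and> distinct xs \<and> set xs \<subseteq> B}"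
  have \<phi>A: "\<phi> xs i \<in> A" if "i \<in> {1..n}" for xs i
    using that \<alpha> by (auto simp: \<phi>_def bij_betw_def)
  have \<phi>B: "\<phi> xs i \<in> B" if "i \<in> {n<..n + k}" "xs \<in> ?S" for xs i
    using that by (auto simp: \<phi>_def)
  have "H xs \<in> labeled_graphs X (n + k)" if xs: "xs \<in> ?S" for xs
  proof -
    have split: "{1..n + k} = {1..n} \<union> {n<..n + k}" by auto
    have img: "\<phi> xs ` {1..n} \<subseteq> A" "\<phi> xs ` {n<..n + k} \<subseteq> B"
      using \<phi>A \<phi>B[OF _ xs] by blast+
    have "inj_on \<alpha> {1..n}" using \<alpha> by (rule bij_betw_imp_inj_on)
    then have "inj_on (\<phi> xs) {1..n}"
      using inj_on_cong[of "{1..n}" "\<phi> xs" \<alpha>] by (simp add: \<phi>_def)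
    moreover have "inj_on (\<phi> xs) {n<..n + k}"
    proof (rule inj_onI)
      fix i j assume ij: "i \<in> {n<..n + k}" "j \<in> {n<..n + k}" "\<phi> xs i = \<phi> xs j"
      then have "xs ! (i - n - 1) = xs ! (j - n - 1)" by (simp add: \<phi>_def)
      moreover have "i - n - 1 < length xs" "j - n - 1 < length xs" using ij xs by auto
      ultimately have "i - n - 1 = j - n - 1" using xs by (simp add: nth_eq_iff_index_eq)
      then show "i = j" using ij by auto
    qed
    moreover have "\<phi> xs ` {1..n} \<inter> \<phi> xs ` {n<..n + k} = {}" using img B(1) by blast
    ultimately have "inj_on (\<phi> xs) {1..n + k}" unfolding split inj_on_Un by blast
    moreover have "\<phi> xs ` {1..n + k} \<subseteq> pverts G"
      unfolding split image_Un using img A B(1) by blast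
    ultimately show ?thesis
      using hereditary_pullback[OF X, of "\<phi> xs" "{1..n + k}"] by (simp add: labeled_graphs_def H_def)
  qed
  moreover have "inj_on H ?S"
  proof (rule inj_onI)
    fix xs ys assume xs: "xs \<in> ?S" and ys: "ys \<in> ?S" and eq: "H xs = H ys"
    show "xs = ys"
    proof (rule nth_equalityI)
      show "length xs = length ys" using xs ys by simp
      fix m assume m: "m < length xs"
      \<comment> \<open>In \<open>H xs\<close>, the adjacencies of vertex \<open>n + 1 + m\<close>
        to the first \<open>n\<close> vertices spell out the trace of \<open>xs ! m\<close> on
        \<open>A\<close>.\<close>
      have "(xs ! m, a) \<in> parcs G \<longleftrightarrow> (ys ! m, a) \<in> parcs G" if "a \<in> A" for a
      proof -
        obtain j where j: "j \<in> {1..n}" "\<alpha> j = a"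
          using bij_betw_imp_surj_on[OF \<alpha>] \<open>a \<in> A\<close> by blast
        have "(n + 1 + m, j) \<in> parcs (H xs) \<longleftrightarrow> (n + 1 + m, j) \<in> parcs (H ys)" by (simp only: eq)
        then show ?thesis using j m xs by (simp add: H_def \<phi>_def)
      qed
      then have "nbhd G (xs ! m) \<inter> A = nbhd G (ys ! m) \<inter> A" by auto
      moreover have "xs ! m \<in> B" "ys ! m \<in> B" using m xs ys by auto
      ultimately show "xs ! m = ys ! m" using inj by (auto dest: inj_onD)
    qed
  qed
  ultimately have "card ?S \<le> card (labeled_graphs X (n + k))"
    using X(1) by (intro card_inj_on_le[of H] finite_labeled_graphs) (auto simp: hereditary_def)
  moreover have "card ?S = \<Prod>{card B - k + 1..card B}"
    using card_lists_distinct_length_eq[OF fin(2) B(2)] by simp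
  moreover have "(\<Prod>i\<in>{card B - k + 1..card B}. card B - k) \<le> \<Prod>{card B - k + 1..card B}"
    by (intro prod_mono) auto
  ultimately show ?thesis using B(2) by (simp add: n_def)
qed

text \<open>With \<open>y = c * n * (L + 1)\<close>, taking \<open>n\<close>-th roots gives
  \<open>x ^ L \<le> y ^ Suc L\<close>. As \<open>n \<le> 2 ^ L\<close>, the surplus factor
  \<open>y\<close> is at most \<open>(4 * c) ^ L\<close>, which costs only a constant after the
  \<open>L\<close>-th root.\<close>

lemma root_bound:
  fixes x c :: real
  assumes "x \<ge> 0" "c \<ge> 1" "n \<ge> 1" "L \<ge> 1" "n \<le> 2 ^ L"
    and le: "x ^ (n * L) \<le> fact (n + n * L) * c ^ (n + n * L)"
  shows "x \<le> 4 * c\<^sup>2 * n * (L + 1)"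
proof -
  define y where "y = c * n * (L + 1)"
  have "y \<ge> 0" using assms by (simp add: y_def)
  have "fact (n + n * L) \<le> real (n + n * L) ^ (n + n * L)"
    using fact_le_power[of "n + n * L", where ?'a = real] by simp
  then have "x ^ (n * L) \<le> real (n + n * L) ^ (n + n * L) * c ^ (n + n * L)"
    using le assms(2) by (meson mult_right_mono order_trans zero_le_power zero_le_one)
  also have "\<dots> = (y ^ Suc L) ^ n"
    by (simp only: power_mult[symmetric] power_mult_distrib[symmetric] y_def)
      (simp add: algebra_simps)
  finally have "(x ^ L) ^ n \<le> (y ^ Suc L) ^ n"
    by (simp only: power_mult[symmetric] mult.commute[of L])
  then have "x ^ L \<le> y ^ Suc L"
    using assms \<open>y \<ge> 0\<close> by (subst (asm) power_mono_iff) auto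
  also have "\<dots> \<le> y ^ L * (4 * c) ^ L"
  proof -
    have "y \<le> c ^ L * 2 ^ L * 2 ^ L"
      unfolding y_def
    proof (intro mult_mono)
      show "c \<le> c ^ L" using self_le_power[of c L] assms by simp
      show "real n \<le> 2 ^ L" using assms(5) by (metis of_nat_le_iff of_nat_numeral of_nat_power)
      have "L + 1 \<le> 2 ^ L" by (simp add: Suc_le_eq)
      then show "real (L + 1) \<le> 2 ^ L" by (metis of_nat_le_iff of_nat_numeral of_nat_power)
    qed (use assms in auto)
    also have "\<dots> = (4 * c) ^ L"
      by (simp only: power_mult_distrib[symmetric]) (simp add: mult.commute)
    finally have "y * y ^ L \<le> (4 * c) ^ L * y ^ L" using \<open>y \<ge> 0\<close> by (intro mult_right_mono) auto
    then show ?thesis by (simp only: power_Suc mult.commute)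
  qed
  finally have "x ^ L \<le> (4 * c * y) ^ L" by (simp add: power_mult_distrib mult_ac)
  then have "x \<le> 4 * c * y"
    using assms \<open>y \<ge> 0\<close> by (subst (asm) power_mono_iff) auto
  then show ?thesis by (simp add: y_def power2_eq_square mult_ac)
qed

lemma small_class_near_linear_traces:
  assumes X: "hereditary X" and small: "small_class X"
  obtains D where "\<And>G. G \<in> X \<Longrightarrow> near_linear_traces (nbhd G) (pverts G) D"
proof -
  obtain c0 where c0: "\<And>n. real (card (labeled_graphs X n)) \<le> fact n * c0 ^ n"
    using small by (auto simp: small_class_def)
  \<comment> \<open>The smallness constant may be any real number; \<open>root_bound\<close> needs
    at least 1.\<close>
  define c where "c = max 1 \<bar>c0\<bar>"
  have c: "c \<ge> 1" by (simp add: c_def)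
  have count: "real (card (labeled_graphs X n)) \<le> fact n * c ^ n" for n
  proof -
    have "c0 ^ n \<le> \<bar>c0\<bar> ^ n" by (metis abs_ge_self power_abs)
    also have "\<dots> \<le> c ^ n" by (intro power_mono) (auto simp: c_def)
    finally show ?thesis using c0[of n] by (meson fact_ge_zero mult_left_mono order_trans)
  qed
  \<comment> \<open>This exceeds twice \<open>1 + 4 * c\<^sup>2\<close>; the factor 2 arises from
    replacing \<open>M + 1\<close> by \<open>2 * (L + 1)\<close>.\<close>
  define D where "D = nat \<lceil>4 + 8 * c\<^sup>2\<rceil>"
  have D: "4 + 8 * c\<^sup>2 \<le> real D" by (simp add: D_def of_nat_ceiling)
  then have "1 \<le> D" using zero_le_power2[of c] by linarith
  show ?thesis
  proof (rule that)
    fix G assume G: "G \<in> X"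
    let ?V = "pverts G" and ?N = "nbhd G"
    have finV: "finite ?V" by (rule hereditary_pair_graph(1)[OF X G])
    show "near_linear_traces ?N ?V D"
      unfolding near_linear_traces_def
    proof (intro allI impI)
      fix A L assume A: "A \<subseteq> ?V" "card A \<le> 2 ^ L"
      let ?tr = "\<lambda>u. ?N u \<inter> A"
      define n where "n = card A"
      \<comment> \<open>The added 1 ensures that \<open>M\<close> is positive even for
        \<open>L = 0\<close>.\<close>
      define M where "M = L + 1"
      have finA: "finite A" using A finV finite_subset by blast
      show "card (?tr ` ?V) \<le> D * (card A + 1) * (L + 1)"
      proof (cases "n = 0")
        case True
        then have "?tr ` ?V \<subseteq> {{}}" using finA by (auto simp: n_def)
        then have "card (?tr ` ?V) \<le> 1" using card_mono[of "{{}}" "?tr ` ?V"] by simp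
        also have "1 \<le> D * (card A + 1) * (L + 1)"
          using \<open>1 \<le> D\<close> by (simp add: Suc_le_eq)
        finally show ?thesis .
      next
        case False
        \<comment> \<open>\<open>B\<close> represents each trace of a vertex outside
          \<open>A\<close> once; the vertices of \<open>A\<close> add at most \<open>n\<close>
          traces.\<close>
        from iffD1[OF subset_image_inj[of "?tr ` (?V - A)" ?tr "?V - A"] subset_refl] obtain B
          where B: "B \<subseteq> ?V - A" "inj_on ?tr B" "?tr ` (?V - A) = ?tr ` B"
          by blast
        have V: "?V - A \<union> A = ?V" using A(1) by blast
        have "?tr ` ?V = ?tr ` B \<union> ?tr ` A"
          by (simp only: B(3)[symmetric] image_Un[symmetric] V)
        then have "card (?tr ` ?V) \<le> card (?tr ` B) + card (?tr ` A)" by (simp add: card_Un_le)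
        also have "\<dots> \<le> card B + n"
          using card_image_le[OF finA, of ?tr] B(2) by (simp add: card_image n_def)
        finally have tr: "card (?tr ` ?V) \<le> card B + n" .
        have "real (card B - n * M) \<le> 4 * c\<^sup>2 * n * (M + 1)"
        proof (cases "n * M \<le> card B")
          case True
          have "real ((card B - n * M) ^ (n * M)) \<le> real (card (labeled_graphs X (n + n * M)))"
            using labeled_graphs_ge[OF X G A(1) B(1) True B(2)] by (simp only: n_def of_nat_le_iff)
          from order_trans[OF this count]
          have "real (card B - n * M) ^ (n * M) \<le> fact (n + n * M) * c ^ (n + n * M)"
            by (simp only: of_nat_power)
          moreover have "n \<le> 2 ^ M" using A(2) by (simp add: n_def M_def)
          ultimately show ?thesis using False c by (intro root_bound) (auto simp: M_def)
        qed (use c in simp)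
        then have "real (card (?tr ` ?V)) \<le> real n + real n * real M + 4 * c\<^sup>2 * n * (M + 1)"
          using tr by (simp flip: of_nat_mult)
        also have "\<dots> = (1 + 4 * c\<^sup>2) * (real n * real (M + 1))" by (simp add: algebra_simps)
        also have "\<dots> \<le> (1 + 4 * c\<^sup>2) * (2 * (real (n + 1) * real (L + 1)))"
          by (intro mult_left_mono) (auto simp: M_def algebra_simps)
        also have "\<dots> \<le> (4 + 8 * c\<^sup>2) * (real (n + 1) * real (L + 1))"
          by (simp add: algebra_simps)
        also have "\<dots> \<le> real D * (real (n + 1) * real (L + 1))"
          using D by (intro mult_right_mono) auto
        also have "\<dots> = real (D * (card A + 1) * (L + 1))" by (simp add: n_def algebra_simps)
        finally show ?thesis by (simp only: of_nat_le_iff)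
      qed
    qed
  qed
qed

section \<open>Label lengths and the labeling scheme\<close>

text \<open>At most \<open>(3 + 4 * packing_const D) * (L + 1)\<^sup>2\<close> numbers are stored,
  with at most \<open>3 * (L + 1)\<close> bits each.\<close>

definition label_bound :: "nat \<Rightarrow> nat \<Rightarrow> nat" where
  "label_bound D L = (9 + 12 * packing_const D) * (L + 1) ^ 3"

lemma label_bound_ge:
  "(1 + (L + 1) + level_const D L) * (2 * (L + 1) + 1) \<le> label_bound D L"
proof -
  define m where "m = L + 1"
  have "m \<ge> 1" by (simp add: m_def)
  have "1 + m + level_const D L \<le> (3 + 4 * packing_const D) * m\<^sup>2"
  proof -
    have "m \<le> m\<^sup>2" "1 \<le> m\<^sup>2" using \<open>m \<ge> 1\<close> by (auto simp: power2_eq_square)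
    moreover have "level_const D L = 4 * packing_const D * m\<^sup>2 + 1"
      by (simp add: level_const_def m_def power2_eq_square algebra_simps)
    ultimately show ?thesis by (simp add: algebra_simps)
  qed
  moreover have "2 * m + 1 \<le> 3 * m" using \<open>m \<ge> 1\<close> by simp
  ultimately have "(1 + m + level_const D L) * (2 * m + 1) \<le> (3 + 4 * packing_const D) * m\<^sup>2 * (3 * m)"
    by (rule mult_le_mono)
  also have "\<dots> = (9 + 12 * packing_const D) * m ^ 3"
    by (simp add: power2_eq_square power3_eq_cube algebra_simps)
  finally show ?thesis by (simp only: label_bound_def m_def)
qed

lemma ex_bit_labels:
  assumes N: "near_linear_traces N V D" "finite V" "card V \<le> 2 ^ L"
    and sym: "\<forall>u\<in>V. \<forall>v\<in>V. u \<in> N v \<longleftrightarrow> v \<in> N u"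
  shows "\<exists>lab. (\<forall>v\<in>V. length (encode_label (lab v)) \<le> label_bound D L) \<and>
    (\<forall>u\<in>V. \<forall>v\<in>V. dec_label (lab u) (lab v) \<longleftrightarrow> v \<in> N u)"
proof -
  have "card V < 2 ^ (L + 1)" using N(3) by (simp add: le_less_trans)
  from ex_labels[OF N sym this] obtain lab where
    lab: "\<And>v. v \<in> V \<Longrightarrow> length (fst (lab v)) \<le> L + 1 \<and> length (snd (lab v)) \<le> level_const D L \<and>
        set (fst (lab v)) \<union> set (snd (lab v)) \<subseteq> {..<card V}"
      "\<forall>u\<in>V. \<forall>v\<in>V. dec_label (lab u) (lab v) \<longleftrightarrow> v \<in> N u" by blast
  have "length (encode_label (lab v)) \<le> label_bound D L" if "v \<in> V" for v
  proof -
    obtain ps c where l: "lab v = (ps, c)" by fastforce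
    have "length ps < 2 ^ (L + 1)"
      using lab(1)[OF that] less_exp[of "L + 1"] by (simp add: l)
    moreover have "{..<card V} \<subseteq> {..<2 ^ (L + 1)}" using \<open>card V < 2 ^ (L + 1)\<close> by auto
    ultimately have "length (encode_label (lab v)) \<le> (1 + length ps + length c) * (2 * (L + 1) + 1)"
      using lab(1)[OF that] unfolding l by (intro length_encode_label) auto
    also have "\<dots> \<le> (1 + (L + 1) + level_const D L) * (2 * (L + 1) + 1)"
      using lab(1)[OF that] by (intro mult_le_mono1 add_mono) (auto simp: l)
    also have "\<dots> \<le> label_bound D L" by (rule label_bound_ge)
    finally show ?thesis .
  qed
  with lab(2) show ?thesis by blast
qed

lemma label_bound_bigo:
  "(\<lambda>n. real (Suc (label_bound D (nat \<lceil>log 2 (real n)\<rceil>)))) \<in> O(\<lambda>n. (log 2 (real n)) ^ 3)"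
\<comment> \<open>From \<open>n = 2\<close> on, the rounded logarithm plus 1 is at most 3 times the
  logarithm, and 27 is the cube of 3. The 10 in place of 9 absorbs \<open>Suc\<close>.\<close>
proof (rule bigoI[of _ "27 * real (10 + 12 * packing_const D)"])
  show "\<forall>\<^sub>F n in sequentially. norm (real (Suc (label_bound D (nat \<lceil>log 2 (real n)\<rceil>))))
      \<le> 27 * real (10 + 12 * packing_const D) * norm ((log 2 (real n)) ^ 3)"
    using eventually_ge_at_top[of 2]
  proof eventually_elim
    case (elim n)
    define L where "L = nat \<lceil>log 2 (real n)\<rceil>"
    have log: "1 \<le> log 2 (real n)" using elim by (simp add: le_log_iff)
    have "real (L + 1) \<le> 3 * log 2 (real n)" using log unfolding L_def by linarith
    then have "real (L + 1) ^ 3 \<le> (3 * log 2 (real n)) ^ 3" by (intro power_mono) auto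
    then have cube: "real (L + 1) ^ 3 \<le> 27 * log 2 (real n) ^ 3" by (simp add: power_mult_distrib)
    have "Suc (label_bound D L) \<le> (10 + 12 * packing_const D) * (L + 1) ^ 3"
      by (simp add: label_bound_def algebra_simps)
    then have "real (Suc (label_bound D L)) \<le> real (10 + 12 * packing_const D) * real (L + 1) ^ 3"
      by (metis of_nat_le_iff of_nat_mult of_nat_power)
    also have "\<dots> \<le> real (10 + 12 * packing_const D) * (27 * log 2 (real n) ^ 3)"
      using cube by (intro mult_left_mono) auto
    finally show ?case using log by (simp add: L_def algebra_simps)
  qed
qed

theorem theorem1p3:
  fixes X :: "nat pair_pre_digraph set"
  assumes "hereditary X"
    and "small_class X"
  shows "\<exists>(b :: nat \<Rightarrow> nat) enc dec.
           (\<lambda>n. real (b n)) \<in> O(\<lambda>n. (log 2 (real n)) ^ 3) \<and>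
           adjacency_labeling_scheme b X enc dec"
proof -
  obtain D where D: "\<And>G. G \<in> X \<Longrightarrow> near_linear_traces (nbhd G) (pverts G) D"
    using small_class_near_linear_traces[OF assms] by blast
  define m where "m n = label_bound D (nat \<lceil>log 2 (real n)\<rceil>)" for n :: nat
  have "\<exists>lab. G \<in> X \<longrightarrow> (\<forall>v\<in>pverts G. length (encode_label (lab v)) \<le> m (card (pverts G))) \<and>
      (\<forall>u\<in>pverts G. \<forall>v\<in>pverts G. dec_label (lab u) (lab v) \<longleftrightarrow> (u, v) \<in> parcs G)" for G
  proof (cases "G \<in> X")
    case True
    then have G: "finite (pverts G)" "sym (parcs G)"
      using hereditary_pair_graph[OF assms(1)] by auto
    let ?n = "card (pverts G)"
    have "?n \<le> 2 ^ nat \<lceil>log 2 (real ?n)\<rceil>"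
    \<comment> \<open>The empty graph is separate because \<open>2 powr log 2 0\<close> is not
      0.\<close>
    proof (cases "?n = 0")
      case False
      then have "real ?n = 2 powr log 2 (real ?n)" by simp
      also have "\<dots> \<le> 2 powr real (nat \<lceil>log 2 (real ?n)\<rceil>)"
        by (intro powr_mono real_nat_ceiling_ge) simp
      also have "\<dots> = real (2 ^ nat \<lceil>log 2 (real ?n)\<rceil>)" by (simp add: powr_realpow)
      finally show ?thesis by (simp only: of_nat_le_iff)
    qed simp
    moreover have "\<forall>u\<in>pverts G. \<forall>v\<in>pverts G. u \<in> nbhd G v \<longleftrightarrow> v \<in> nbhd G u"
      using G(2) by (auto dest: symD)
    ultimately show ?thesis
      using ex_bit_labels[OF D[OF True] G(1)] by (simp add: m_def)
  qed simp
  then obtain lab where lab: "\<And>G. G \<in> X \<Longrightarrow>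
      (\<forall>v\<in>pverts G. length (encode_label (lab G v)) \<le> m (card (pverts G))) \<and>
      (\<forall>u\<in>pverts G. \<forall>v\<in>pverts G. dec_label (lab G u) (lab G v) \<longleftrightarrow> (u, v) \<in> parcs G)"
    by metis
  define enc where "enc G v = pad (m (card (pverts G))) (encode_label (lab G v))" for G v
  \<comment> \<open>No graph enters here: the marker delimits the padding, and injectivity of
    \<open>encode_label\<close> recovers the label.\<close>
  define dec where "dec s t = dec_label (inv encode_label (unpad s)) (inv encode_label (unpad t))" for s t
  have "adjacency_labeling_scheme (\<lambda>n. Suc (m n)) X enc dec"
    unfolding adjacency_labeling_scheme_def
  proof (intro allI ballI conjI)
    fix n G v assume "G \<in> labeled_graphs X n" "v \<in> pverts G"
    then show "length (enc G v) = Suc (m n)"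
      using lab[of G] by (auto simp: labeled_graphs_def enc_def length_pad)
  next
    fix n G u v assume "G \<in> labeled_graphs X n" "u \<in> pverts G" "v \<in> pverts G"
    then show "dec (enc G u) (enc G v) \<longleftrightarrow> (u, v) \<in> parcs G"
      using lab[of G]
      by (auto simp: labeled_graphs_def enc_def dec_def unpad_pad inv_f_f[OF inj_encode_label])
  qed
  with label_bound_bigo[of D] show ?thesis
    by (intro exI[of _ "\<lambda>n. Suc (m n)"] exI[of _ enc] exI[of _ dec] conjI) (simp_all only: m_def)
qed

end
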